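(* Let $r\ge 1$ be an integer. For every integer $n\ge 0$, \[ D_{r,\mathcal{A}}(n)=\sum_{j=0}^{r-1} b_{r,j}(n)\,D_{r,\mathcal{A}}(j)+g_r(n)\quad\text{in }\mathcal{A}, \] where, for $0\le j\le r-1$, the integers $b_{r,j}(n)$ are defined by $b_{r,j}(n)=\delta_{j,n}$ for $0\le n\le r-1$ and $b_{r,j}(n+r)=\sum_{k=0}^{n}\binom{n}{k}b_{r,j}(k)$ for $n\ge0$, and the integer sequence $(g_r(n))_{n\ge0}$ is defined by $g_r(n)=(-1)^{r-1}\delta_{n,r}$ for $0\le n\le r$ and $g_r(n+r)=\sum_{k=0}^{n}\binom{n}{k}g_r(k)$ for $n\ge 1$.
   Context: $\mathcal{A}\coloneqq\big(\prod_{p\text{ prime}}\mathbb{Z}/p\mathbb{Z}\big)/\big(\bigoplus_{p\text{ prime}}\mathbb{Z}/p\mathbb{Z}\big)$, a $\mathbb{Q}$-algebra via the diagonal embedding of $\mathbb{Q}$ (for the finitely many primes dividing a denominator, the $p$-component is assigned arbitrarily). For integers $r\ge1$, $n\ge0$, $D_{r,\mathcal{A}}(n)\coloneqq\big(\sum_{k=0}^{p-1}\frac{k^n}{(k!)^r}\bmod p\big)_p\in\mathcal{A}$, with the convention $0^0=1$. $\delta$ denotes the Kronecker delta. *)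

theory Defs
  imports
    "HOL-Algebra.QuotRing"
    "HOL-Number_Theory.Number_Theory"
begin

section \<open>The ring \<open>\<A>\<close>\<close>

definition product_ring ::
    "'i set \<Rightarrow> ('i \<Rightarrow> ('a, 'm) ring_scheme) \<Rightarrow> ('i \<Rightarrow> 'a) ring" where
  "product_ring I R =
     \<lparr>carrier = (\<Pi>\<^sub>E i\<in>I. carrier (R i)),
      monoid.mult = (\<lambda>x y. \<lambda>i\<in>I. x i \<otimes>\<^bsub>R i\<^esub> y i),
      one = (\<lambda>i\<in>I. \<one>\<^bsub>R i\<^esub>),
      ring.zero = (\<lambda>i\<in>I. \<zero>\<^bsub>R i\<^esub>),
      ring.add = (\<lambda>x y. \<lambda>i\<in>I. x i \<oplus>\<^bsub>R i\<^esub> y i)\<rparr>"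

definition direct_sum ::
    "'i set \<Rightarrow> ('i \<Rightarrow> ('a, 'm) ring_scheme) \<Rightarrow> ('i \<Rightarrow> 'a) set" where
  "direct_sum I R =
     {x \<in> carrier (product_ring I R). finite {i \<in> I. x i \<noteq> \<zero>\<^bsub>R i\<^esub>}}"

abbreviation primes :: "nat set" where
  "primes \<equiv> {p. prime p}"

abbreviation prod_Zp :: "(nat \<Rightarrow> int) ring" where
  "prod_Zp \<equiv> product_ring primes (\<lambda>p. residue_ring (int p))"

abbreviation sum_Zp :: "(nat \<Rightarrow> int) set" where
  "sum_Zp \<equiv> direct_sum primes (\<lambda>p. residue_ring (int p))"

definition \<A> :: "(nat \<Rightarrow> int) set ring" where
  "\<A> = prod_Zp Quot sum_Zp"

definition \<A>_class :: "(nat \<Rightarrow> int) \<Rightarrow> (nat \<Rightarrow> int) set" where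
  "\<A>_class f = sum_Zp +>\<^bsub>prod_Zp\<^esub> (\<lambda>p\<in>primes. f p)"

text \<open>
  Reduction of a rational number modulo \<open>p\<close>. If \<open>p\<close> divides the denominator, then
  \<^const>\<open>modular_inverse\<close> returns \<open>0\<close>, and so does this function; this is the
  arbitrary value at the finitely many bad primes.
\<close>

definition rat_mod :: "nat \<Rightarrow> rat \<Rightarrow> int" where
  "rat_mod p q =
     (case quotient_of q of (a, b) \<Rightarrow> (a * modular_inverse (int p) b) mod int p)"

definition \<A>_of_rat :: "rat \<Rightarrow> (nat \<Rightarrow> int) set" where
  "\<A>_of_rat q = \<A>_class (\<lambda>p. rat_mod p q)"

section \<open>The elements \<open>D\<^sub>r\<^sub>,\<^sub>\<A>(n)\<close> and the coefficient sequences\<close>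

text \<open>
  All summands with \<open>k < p\<close> are \<open>p\<close>-integral, so the \<open>p\<close>-component is the genuine
  reduction of the rational sum.
\<close>

definition D_\<A> :: "nat \<Rightarrow> nat \<Rightarrow> (nat \<Rightarrow> int) set" where
  "D_\<A> r n = \<A>_class (\<lambda>p. rat_mod p (\<Sum>k=0..p-1. of_nat k ^ n / fact k ^ r))"

text \<open>
  The disjuncts \<open>r = 0\<close> only serve termination; see \<open>b_rec\<close> and \<open>g_rec\<close> below for the
  recurrences.
\<close>

fun b :: "nat \<Rightarrow> nat \<Rightarrow> nat \<Rightarrow> int" where
  "b r j n = (if r = 0 \<or> n < r then (if j = n then 1 else 0)
              else (\<Sum>k=0..n-r. of_nat ((n - r) choose k) * b r j k))"

fun g :: "nat \<Rightarrow> nat \<Rightarrow> int" where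
  "g r n = (if r = 0 \<or> n \<le> r then (if n = r then (-1) ^ (r - 1) else 0)
            else (\<Sum>k=0..n-r. of_nat ((n - r) choose k) * g r k))"

declare b.simps [simp del] g.simps [simp del]

lemma b_init: "n < r \<Longrightarrow> b r j n = (if j = n then 1 else 0)"
  by (simp add: b.simps)

lemma b_rec: "r \<ge> 1 \<Longrightarrow> b r j (n + r) = (\<Sum>k=0..n. of_nat (n choose k) * b r j k)"
  by (subst b.simps) simp

lemma g_init: "n \<le> r \<Longrightarrow> g r n = (if n = r then (-1) ^ (r - 1) else 0)"
  by (simp add: g.simps)

lemma g_rec: "r \<ge> 1 \<Longrightarrow> n \<ge> 1 \<Longrightarrow> g r (n + r) = (\<Sum>k=0..n. of_nat (n choose k) * g r k)"
  by (subst g.simps) simp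

section \<open>Well-definedness\<close>

lemma cring_product_ring:
  assumes "\<And>i. i \<in> I \<Longrightarrow> cring (R i)"
  shows "cring (product_ring I R)"
proof -
  have ring: "ring (R i)" if "i \<in> I" for i
    using assms[OF that] by (rule cring.axioms)
  have inv: "\<exists>y\<in>carrier (product_ring I R).
      y \<oplus>\<^bsub>product_ring I R\<^esub> x = \<zero>\<^bsub>product_ring I R\<^esub>"
    if "x \<in> carrier (product_ring I R)" for x
    by (rule bexI[of _ "\<lambda>i\<in>I. \<ominus>\<^bsub>R i\<^esub> x i"])
       (use that in \<open>auto simp: product_ring_def PiE_iff abelian_group.l_neg
          abelian_group.a_inv_closed ring.is_abelian_group[OF ring] intro!: restrict_ext\<close>)
  have l_one: "(\<lambda>i\<in>I. (if i \<in> I then u i else undefined)) = (\<lambda>i\<in>I. u i)" for u :: "'a \<Rightarrow> 'b"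
    by auto
  show ?thesis
  proof (intro cringI abelian_groupI comm_monoidI)
    fix x y z
    assume "x \<in> carrier (product_ring I R)" "y \<in> carrier (product_ring I R)"
      "z \<in> carrier (product_ring I R)"
    then have x: "\<And>i. i \<in> I \<Longrightarrow> x i \<in> carrier (R i)" "\<And>i. i \<notin> I \<Longrightarrow> x i = undefined"
      and y: "\<And>i. i \<in> I \<Longrightarrow> y i \<in> carrier (R i)" "\<And>i. i \<notin> I \<Longrightarrow> y i = undefined"
      and z: "\<And>i. i \<in> I \<Longrightarrow> z i \<in> carrier (R i)"
      by (auto simp: product_ring_def PiE_iff extensional_def)
    show "x \<oplus>\<^bsub>product_ring I R\<^esub> y \<oplus>\<^bsub>product_ring I R\<^esub> z =
          x \<oplus>\<^bsub>product_ring I R\<^esub> (y \<oplus>\<^bsub>product_ring I R\<^esub> z)"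
      by (auto simp: product_ring_def x y z ring.ring_simprules[OF ring] intro!: restrict_ext)
    show "x \<otimes>\<^bsub>product_ring I R\<^esub> y \<otimes>\<^bsub>product_ring I R\<^esub> z =
          x \<otimes>\<^bsub>product_ring I R\<^esub> (y \<otimes>\<^bsub>product_ring I R\<^esub> z)"
      by (auto simp: product_ring_def x y z ring.ring_simprules[OF ring] intro!: restrict_ext)
    show "(x \<oplus>\<^bsub>product_ring I R\<^esub> y) \<otimes>\<^bsub>product_ring I R\<^esub> z =
          x \<otimes>\<^bsub>product_ring I R\<^esub> z \<oplus>\<^bsub>product_ring I R\<^esub> y \<otimes>\<^bsub>product_ring I R\<^esub> z"
      by (auto simp: product_ring_def x y z ring.ring_simprules[OF ring] intro!: restrict_ext)
  next
    fix x y
    assume "x \<in> carrier (product_ring I R)" "y \<in> carrier (product_ring I R)"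
    then have x: "\<And>i. i \<in> I \<Longrightarrow> x i \<in> carrier (R i)" "\<And>i. i \<notin> I \<Longrightarrow> x i = undefined"
      and y: "\<And>i. i \<in> I \<Longrightarrow> y i \<in> carrier (R i)" "\<And>i. i \<notin> I \<Longrightarrow> y i = undefined"
      by (auto simp: product_ring_def PiE_iff extensional_def)
    show "x \<oplus>\<^bsub>product_ring I R\<^esub> y \<in> carrier (product_ring I R)"
      "x \<otimes>\<^bsub>product_ring I R\<^esub> y \<in> carrier (product_ring I R)"
      by (auto simp: product_ring_def x y ring.ring_simprules[OF ring])
    show "x \<oplus>\<^bsub>product_ring I R\<^esub> y = y \<oplus>\<^bsub>product_ring I R\<^esub> x"
      by (auto simp: product_ring_def x y abelian_monoid.a_comm
            abelian_group.axioms(1)[OF ring.is_abelian_group[OF ring]] intro!: restrict_ext)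
    show "x \<otimes>\<^bsub>product_ring I R\<^esub> y = y \<otimes>\<^bsub>product_ring I R\<^esub> x"
      by (auto simp: product_ring_def x y cring.cring_simprules(14)[OF assms] intro!: restrict_ext)
  next
    fix x
    assume xc: "x \<in> carrier (product_ring I R)"
    then have x: "\<And>i. i \<in> I \<Longrightarrow> x i \<in> carrier (R i)" "\<And>i. i \<notin> I \<Longrightarrow> x i = undefined"
      by (auto simp: product_ring_def PiE_iff extensional_def)
    show "\<zero>\<^bsub>product_ring I R\<^esub> \<oplus>\<^bsub>product_ring I R\<^esub> x = x"
      "\<one>\<^bsub>product_ring I R\<^esub> \<otimes>\<^bsub>product_ring I R\<^esub> x = x"
      by (auto simp: product_ring_def x fun_eq_iff ring.ring_simprules[OF ring])
  next
    show "\<zero>\<^bsub>product_ring I R\<^esub> \<in> carrier (product_ring I R)"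
      "\<one>\<^bsub>product_ring I R\<^esub> \<in> carrier (product_ring I R)"
      by (auto simp: product_ring_def ring.ring_simprules[OF ring])
  qed (fact inv)
qed

lemma ideal_direct_sum:
  assumes "\<And>i. i \<in> I \<Longrightarrow> cring (R i)"
  shows "ideal (direct_sum I R) (product_ring I R)"
proof -
  have ring: "ring (R i)" if "i \<in> I" for i
    using assms[OF that] by (rule cring.axioms)
  interpret P: cring "product_ring I R"
    using assms by (rule cring_product_ring)
  have neg: "(\<lambda>i\<in>I. \<ominus>\<^bsub>R i\<^esub> x i) = \<ominus>\<^bsub>product_ring I R\<^esub> x"
    if "x \<in> carrier (product_ring I R)" for x
  proof (rule P.minus_equality[symmetric])
    show "(\<lambda>i\<in>I. \<ominus>\<^bsub>R i\<^esub> x i) \<oplus>\<^bsub>product_ring I R\<^esub> x = \<zero>\<^bsub>product_ring I R\<^esub>"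
      "(\<lambda>i\<in>I. \<ominus>\<^bsub>R i\<^esub> x i) \<in> carrier (product_ring I R)"
      using that by (auto simp: product_ring_def PiE_iff ring.ring_simprules[OF ring]
          intro!: restrict_ext)
  qed fact
  show ?thesis
  proof (rule idealI)
    show "subgroup (direct_sum I R) (add_monoid (product_ring I R))"
    proof (rule group.subgroupI)
      show "direct_sum I R \<subseteq> carrier (add_monoid (product_ring I R))"
        by (auto simp: direct_sum_def)
      have "\<zero>\<^bsub>product_ring I R\<^esub> \<in> direct_sum I R"
        using P.zero_closed by (auto simp: direct_sum_def product_ring_def cong: conj_cong)
      then show "direct_sum I R \<noteq> {}" by blast
    next
      fix x assume x: "x \<in> direct_sum I R"
      then have xc: "x \<in> carrier (product_ring I R)"
        and fin: "finite {i \<in> I. x i \<noteq> \<zero>\<^bsub>R i\<^esub>}" by (auto simp: direct_sum_def)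
      have "finite {i \<in> I. (\<ominus>\<^bsub>product_ring I R\<^esub> x) i \<noteq> \<zero>\<^bsub>R i\<^esub>}"
        by (rule finite_subset[OF _ fin])
           (auto simp: neg[OF xc, symmetric] ring.ring_simprules[OF ring])
      then have "\<ominus>\<^bsub>product_ring I R\<^esub> x \<in> direct_sum I R"
        using xc by (simp add: direct_sum_def)
      then show "inv\<^bsub>add_monoid (product_ring I R)\<^esub> x \<in> direct_sum I R"
        by (simp add: a_inv_def)
    next
      fix x y assume x: "x \<in> direct_sum I R" and y: "y \<in> direct_sum I R"
      have fin: "finite ({i \<in> I. x i \<noteq> \<zero>\<^bsub>R i\<^esub>} \<union> {i \<in> I. y i \<noteq> \<zero>\<^bsub>R i\<^esub>})"
        using x y by (auto simp: direct_sum_def)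
      have "finite {i \<in> I. (x \<oplus>\<^bsub>product_ring I R\<^esub> y) i \<noteq> \<zero>\<^bsub>R i\<^esub>}"
        by (rule finite_subset[OF _ fin])
           (auto simp: product_ring_def ring.ring_simprules[OF ring])
      moreover have "x \<oplus>\<^bsub>product_ring I R\<^esub> y \<in> carrier (product_ring I R)"
        using x y by (intro P.a_closed) (auto simp: direct_sum_def)
      ultimately have "x \<oplus>\<^bsub>product_ring I R\<^esub> y \<in> direct_sum I R"
        by (simp add: direct_sum_def)
      then show "x \<otimes>\<^bsub>add_monoid (product_ring I R)\<^esub> y \<in> direct_sum I R"
        by simp
    qed (rule P.add.is_group)
  next
    fix a x assume a: "a \<in> direct_sum I R" and x: "x \<in> carrier (product_ring I R)"
    then have ac: "a \<in> carrier (product_ring I R)"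
      and fin: "finite {i \<in> I. a i \<noteq> \<zero>\<^bsub>R i\<^esub>}" by (auto simp: direct_sum_def)
    have xi: "x i \<in> carrier (R i)" if "i \<in> I" for i
      using x that by (auto simp: product_ring_def PiE_iff)
    have null: "u \<otimes>\<^bsub>R i\<^esub> \<zero>\<^bsub>R i\<^esub> = \<zero>\<^bsub>R i\<^esub>" if "i \<in> I" "u \<in> carrier (R i)" for i u
    proof -
      interpret ring "R i" using ring[OF that(1)] .
      show ?thesis using that(2) by simp
    qed
    have "finite {i \<in> I. (x \<otimes>\<^bsub>product_ring I R\<^esub> a) i \<noteq> \<zero>\<^bsub>R i\<^esub>}"
      by (rule finite_subset[OF _ fin])
         (auto simp: product_ring_def xi null)
    then show xa: "x \<otimes>\<^bsub>product_ring I R\<^esub> a \<in> direct_sum I R"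
      using ac x by (simp add: direct_sum_def)
    then show "a \<otimes>\<^bsub>product_ring I R\<^esub> x \<in> direct_sum I R"
      using P.m_comm[OF x ac] by simp
  qed (rule P.ring_axioms)
qed

lemma cring_residue_ring: "prime p \<Longrightarrow> cring (residue_ring (int p))"
  using prime_gt_1_nat[of p] by (intro residues.cring) (simp add: residues_def)

lemma ideal_sum_Zp: "ideal sum_Zp prod_Zp"
  by (rule ideal_direct_sum) (auto simp: cring_residue_ring)

lemma cring_\<A>: "cring \<A>"
  unfolding \<A>_def
  by (rule ideal.quotient_is_cring[OF ideal_sum_Zp], rule cring_product_ring)
     (auto simp: cring_residue_ring)

lemma \<A>_class_closed:
  assumes "\<And>p. prime p \<Longrightarrow> f p \<in> {0..<int p}"
  shows "\<A>_class f \<in> carrier \<A>"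
proof -
  interpret I: ideal sum_Zp prod_Zp by (rule ideal_sum_Zp)
  have "(\<lambda>p\<in>primes. f p) \<in> carrier prod_Zp"
    using assms by (auto simp: product_ring_def residue_ring_def)
  then show ?thesis
    unfolding \<A>_class_def \<A>_def FactRing_def
    by (simp add: I.a_rcosetsI[OF I.a_subset])
qed

lemma rat_mod_range: "prime p \<Longrightarrow> rat_mod p q \<in> {0..<int p}"
  by (auto simp: rat_mod_def split: prod.split dest: prime_gt_0_nat)

lemma rat_mod_cong:
  assumes "prime p" "\<not> int p dvd d"
  shows "[rat_mod p (of_int a / of_int d) * d = a] (mod int p)"
proof -
  obtain x y where xy: "quotient_of (of_int a / of_int d) = (x, y)"
    by (cases "quotient_of (of_int a / of_int d)")
  have d0: "d \<noteq> 0" using assms by auto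
  have y0: "y > 0" and cop: "coprime x y"
    using quotient_of_denom_pos[OF xy] quotient_of_coprime[OF xy] by auto
  have "(of_int a / of_int d :: rat) = of_int x / of_int y"
    using quotient_of_div[OF xy] .
  then have "of_int (a * y) = (of_int (x * d) :: rat)"
    using d0 y0 by (simp add: field_simps)
  then have eq: "a * y = x * d"
    by (simp only: of_int_eq_iff)
  have pr: "prime (int p)" using assms by simp
  have ny: "\<not> int p dvd y"
  proof
    assume py: "int p dvd y"
    then have "int p dvd x * d" using eq by (metis dvd_mult)
    then have "int p dvd x" using pr assms(2) by (simp add: prime_dvd_mult_iff)
    with py cop have "is_unit (int p)" by (meson coprime_common_divisor)
    with pr show False by auto
  qed
  have copy: "coprime y (int p)"
    using prime_imp_coprime[OF pr ny] by (simp add: coprime_commute)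
  have "[rat_mod p (of_int a / of_int d) * d * y
       = x * modular_inverse (int p) y * d * y] (mod int p)"
    by (auto simp: rat_mod_def xy intro!: cong_mult)
  also have "x * modular_inverse (int p) y * d * y = (y * modular_inverse (int p) y) * (a * y)"
    by (simp add: eq)
  also have "[\<dots> = 1 * (a * y)] (mod int p)"
    by (intro cong_mult cong_modular_inverse1 copy cong_refl)
  finally have "[rat_mod p (of_int a / of_int d) * d * y = a * y] (mod int p)"
    by simp
  then show ?thesis
    using copy by (simp add: cong_mult_rcancel)
qed

lemma prod_Zp_restrict_closed:
  assumes "\<And>p. prime p \<Longrightarrow> f p \<in> {0..<int p}"
  shows "(\<lambda>p\<in>primes. f p) \<in> carrier prod_Zp"
  using assms by (auto simp: product_ring_def residue_ring_def)

lemma \<A>_class_eqI: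
  assumes f: "\<And>p. prime p \<Longrightarrow> f p \<in> {0..<int p}"
    and h: "\<And>p. prime p \<Longrightarrow> h p \<in> {0..<int p}"
    and fin: "finite {p. prime p \<and> f p \<noteq> h p}"
  shows "\<A>_class f = \<A>_class h"
proof -
  interpret I: ideal sum_Zp prod_Zp by (rule ideal_sum_Zp)
  let ?f = "\<lambda>p\<in>primes. f p" and ?h = "\<lambda>p\<in>primes. h p"
  let ?d = "\<lambda>p\<in>primes. (f p - h p) mod int p"
  have fc: "?f \<in> carrier prod_Zp" and hc: "?h \<in> carrier prod_Zp"
    using f h by (intro prod_Zp_restrict_closed; blast)+
  have "?d \<in> carrier prod_Zp"
    by (intro prod_Zp_restrict_closed) (auto dest: prime_gt_0_nat)
  moreover have "finite {p \<in> primes. ?d p \<noteq> \<zero>\<^bsub>residue_ring (int p)\<^esub>}"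
    by (rule finite_subset[OF _ fin]) (auto simp: residue_ring_def)
  ultimately have d: "?d \<in> sum_Zp"
    unfolding direct_sum_def by (intro CollectI conjI)
  have "((f p - h p) mod int p + h p) mod int p = f p" if "prime p" for p
    using f[OF that] by (subst mod_add_left_eq) simp
  then have eq: "?d \<oplus>\<^bsub>prod_Zp\<^esub> ?h = ?f"
    unfolding product_ring_def residue_ring_def ring.simps monoid.simps
    by (intro restrict_ext) simp
  have "?d \<oplus>\<^bsub>prod_Zp\<^esub> ?h \<in> sum_Zp +>\<^bsub>prod_Zp\<^esub> ?h"
    unfolding a_r_coset_def' using d by (intro UN_I[OF d]) simp
  then have "?f \<in> sum_Zp +>\<^bsub>prod_Zp\<^esub> ?h"
    unfolding eq .
  from I.a_repr_independence'[OF this hc] show ?thesis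
    unfolding \<A>_class_def by (rule sym)
qed

lemma \<A>_class_add:
  assumes f: "\<And>p. prime p \<Longrightarrow> f p \<in> {0..<int p}"
    and h: "\<And>p. prime p \<Longrightarrow> h p \<in> {0..<int p}"
  shows "\<A>_class f \<oplus>\<^bsub>\<A>\<^esub> \<A>_class h = \<A>_class (\<lambda>p. (f p + h p) mod int p)"
proof -
  interpret I: ideal sum_Zp prod_Zp by (rule ideal_sum_Zp)
  have "(\<lambda>p\<in>primes. f p) \<oplus>\<^bsub>prod_Zp\<^esub> (\<lambda>p\<in>primes. h p) = (\<lambda>p\<in>primes. (f p + h p) mod int p)"
    by (auto simp: product_ring_def residue_ring_def fun_eq_iff)
  moreover have "(\<lambda>p\<in>primes. f p) \<in> carrier prod_Zp" "(\<lambda>p\<in>primes. h p) \<in> carrier prod_Zp"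
    using f h by (intro prod_Zp_restrict_closed; blast)+
  ultimately show ?thesis
    unfolding \<A>_class_def \<A>_def FactRing_def by (simp add: I.a_rcos_sum)
qed

lemma \<A>_class_mult:
  assumes f: "\<And>p. prime p \<Longrightarrow> f p \<in> {0..<int p}"
    and h: "\<And>p. prime p \<Longrightarrow> h p \<in> {0..<int p}"
  shows "\<A>_class f \<otimes>\<^bsub>\<A>\<^esub> \<A>_class h = \<A>_class (\<lambda>p. (f p * h p) mod int p)"
proof -
  interpret I: ideal sum_Zp prod_Zp by (rule ideal_sum_Zp)
  have "(\<lambda>p\<in>primes. f p) \<otimes>\<^bsub>prod_Zp\<^esub> (\<lambda>p\<in>primes. h p) = (\<lambda>p\<in>primes. (f p * h p) mod int p)"
    by (auto simp: product_ring_def residue_ring_def fun_eq_iff)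
  moreover have "(\<lambda>p\<in>primes. f p) \<in> carrier prod_Zp" "(\<lambda>p\<in>primes. h p) \<in> carrier prod_Zp"
    using f h by (intro prod_Zp_restrict_closed; blast)+
  ultimately show ?thesis
    unfolding \<A>_class_def \<A>_def FactRing_def by (simp add: I.rcoset_mult_add)
qed

lemma rat_mod_eqI:
  assumes "prime p" "\<not> int p dvd d" "[x * d = a] (mod int p)"
  shows "rat_mod p (of_int a / of_int d) = x mod int p"
proof -
  have "coprime d (int p)"
    using prime_imp_coprime[of "int p" d] assms by (simp add: coprime_commute)
  moreover have "[rat_mod p (of_int a / of_int d) * d = x * d] (mod int p)"
    using rat_mod_cong[OF assms(1,2)] assms(3) by (metis cong_sym cong_trans)
  ultimately have "[rat_mod p (of_int a / of_int d) = x] (mod int p)"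
    by (simp add: cong_mult_rcancel)
  then show ?thesis
    using rat_mod_range[OF assms(1)] by (simp add: cong_def)
qed

lemma finite_prime_dvd:
  assumes "d \<noteq> 0"
  shows "finite {p. prime p \<and> int p dvd d}"
proof (rule finite_subset)
  show "{p. prime p \<and> int p dvd d} \<subseteq> {..nat \<bar>d\<bar>}"
  proof safe
    fix p assume "int p dvd d"
    then show "p \<le> nat \<bar>d\<bar>"
      using dvd_imp_le_int[OF assms] by fastforce
  qed
qed simp

lemma rat_fraction:
  obtains a d :: int where "d \<noteq> 0" "q = (of_int a / of_int d :: rat)"
  by (metis quotient_of_div quotient_of_denom_pos less_irrefl surj_pair)

lemma \<A>_of_rat_0: "\<A>_of_rat 0 = \<zero>\<^bsub>\<A>\<^esub>"
  and \<A>_of_rat_1: "\<A>_of_rat 1 = \<one>\<^bsub>\<A>\<^esub>"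
proof -
  interpret I: ideal sum_Zp prod_Zp by (rule ideal_sum_Zp)
  have "(\<lambda>p\<in>primes. rat_mod p 0) = \<zero>\<^bsub>prod_Zp\<^esub>"
    by (auto simp: product_ring_def residue_ring_def rat_mod_def fun_eq_iff)
  then show "\<A>_of_rat 0 = \<zero>\<^bsub>\<A>\<^esub>"
    using I.a_coset_add_zero[OF I.a_subset]
    by (simp add: \<A>_of_rat_def \<A>_class_def \<A>_def FactRing_def)
  have "rat_mod p 1 = 1" if "prime p" for p
    using that prime_gt_1_nat[OF that] by (simp add: rat_mod_def)
  then have "(\<lambda>p\<in>primes. rat_mod p 1) = \<one>\<^bsub>prod_Zp\<^esub>"
    by (auto simp: product_ring_def residue_ring_def fun_eq_iff)
  then show "\<A>_of_rat 1 = \<one>\<^bsub>\<A>\<^esub>"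
    by (simp add: \<A>_of_rat_def \<A>_class_def \<A>_def FactRing_def)
qed

lemma \<A>_of_rat_add: "\<A>_of_rat (q + q') = \<A>_of_rat q \<oplus>\<^bsub>\<A>\<^esub> \<A>_of_rat q'" (is ?add)
  and \<A>_of_rat_mult: "\<A>_of_rat (q * q') = \<A>_of_rat q \<otimes>\<^bsub>\<A>\<^esub> \<A>_of_rat q'" (is ?mult)
proof -
  obtain a d a' d' where d: "d \<noteq> 0" "d' \<noteq> 0"
    and q: "q = of_int a / of_int d" and q': "q' = of_int a' / of_int d'"
    by (metis rat_fraction)
  have s: "q + q' = of_int (a * d' + a' * d) / of_int (d * d')"
    and m: "q * q' = of_int (a * a') / of_int (d * d')"
    using d by (simp_all add: q q' field_simps)
  have fin: "finite {p. prime p \<and> int p dvd d * d'}"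
    using d by (intro finite_prime_dvd) simp
  have good: "rat_mod p (q + q') = (rat_mod p q + rat_mod p q') mod int p \<and>
              rat_mod p (q * q') = (rat_mod p q * rat_mod p q') mod int p"
    if p: "prime p" and nd: "\<not> int p dvd d * d'" for p
  proof -
    have c: "[rat_mod p q * d = a] (mod int p)" "[rat_mod p q' * d' = a'] (mod int p)"
      using nd unfolding q q' by (auto intro!: rat_mod_cong p)
    have "[(rat_mod p q * d) * d' + (rat_mod p q' * d') * d = a * d' + a' * d] (mod int p)"
      "[(rat_mod p q * d) * (rat_mod p q' * d') = a * a'] (mod int p)"
      by (intro cong_add cong_mult c cong_refl)+
    then show ?thesis
      unfolding s m by (intro conjI rat_mod_eqI p nd) (simp_all add: algebra_simps)
  qed
  have range: "x mod int p \<in> {0..<int p}" if "prime p" for x p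
    using prime_gt_0_nat[OF that] by simp
  show ?add
    unfolding \<A>_of_rat_def
    by (subst \<A>_class_add; intro \<A>_class_eqI rat_mod_range range finite_subset[OF _ fin]) (use good in auto)
  show ?mult
    unfolding \<A>_of_rat_def
    by (subst \<A>_class_mult; intro \<A>_class_eqI rat_mod_range range finite_subset[OF _ fin]) (use good in auto)
qed

end

theory Submission
  imports Defs
begin

text \<open>
  Clearing denominators with \<open>((p-1)!)\<^sup>r\<close>, which is \<open>(-1)\<^sup>r\<close> modulo \<open>p\<close> by Wilson's theorem,
  turns the \<open>p\<close>-component of \<open>D\<^sub>r(n)\<close> into \<open>(-1)\<^sup>r\<close> times the integer
  \<open>S(n) = \<Sum>\<^sub>k k\<^sup>n c\<^sub>k\<^sup>r\<close>, where \<open>c\<^sub>k = (p-1)!/k!\<close>. Since \<open>k c\<^sub>k = c\<^sub>k\<^sub>-\<^sub>1\<close>, shifting the summation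
  index gives \<open>S(n + r) = (\<Sum>\<^sub>k binom(n,k) S(k)) - p\<^sup>n\<close>. Modulo \<open>p\<close> the last term survives only
  for \<open>n = 0\<close>, so \<open>S(n)\<close> satisfies the recurrence shared by \<open>b\<close> and \<open>g\<close>, and this holds for
  every prime \<open>p\<close>.
\<close>

text \<open>The natural-number division is exact because k \<le> p - 1.\<close>

definition cleared_sum :: "nat \<Rightarrow> nat \<Rightarrow> nat \<Rightarrow> int" where
  "cleared_sum p r n = (\<Sum>k<p. int k ^ n * int (fact (p - 1) div fact k) ^ r)"

lemma fact_div_fact_Suc:
  assumes "Suc k \<le> m"
  shows "Suc k * (fact m div fact (Suc k)) = fact m div (fact k :: nat)"
proof -
  obtain q :: nat where q: "fact m = fact (Suc k) * q"
    using fact_dvd[OF assms] by (elim dvdE)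
  have "fact m = fact k * (Suc k * q)"
    by (simp add: q algebra_simps)
  then show ?thesis
    using q by (metis fact_nonzero nonzero_mult_div_cancel_left)
qed

lemma cleared_sum_rec:
  assumes "r \<ge> 1" "p \<ge> 1"
  shows "cleared_sum p r (n + r) = (\<Sum>k=0..n. int (n choose k) * cleared_sum p r k) - int p ^ n"
proof -
  obtain m where p: "p = Suc m"
    using assms(2) by (cases p) auto
  define c where "c k = int (fact m div fact k)" for k
  have c_Suc: "int (Suc k) * c (Suc k) = c k" if "k < m" for k
    using fact_div_fact_Suc[of k m] that unfolding c_def of_nat_mult[symmetric] by simp
  \<comment> \<open>The term k = 0 vanishes because n + r \<ge> 1, so the index can be
    shifted.\<close>
  have "cleared_sum p r (n + r) = (\<Sum>k<m. int (Suc k) ^ (n + r) * c (Suc k) ^ r)"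
    using assms(1) by (simp add: cleared_sum_def p c_def sum.lessThan_Suc_shift del: sum.lessThan_Suc of_nat_Suc)
  also have "\<dots> = (\<Sum>k<m. int (Suc k) ^ n * c k ^ r)"
    by (intro sum.cong refl)
       (simp add: power_add c_Suc[symmetric] power_mult_distrib del: of_nat_Suc)
  \<comment> \<open>The added term k = m is p^n, since c(m) = 1.\<close>
  also have "\<dots> = (\<Sum>k<p. int (Suc k) ^ n * c k ^ r) - int p ^ n"
    by (simp add: p c_def)
  also have "(\<Sum>k<p. int (Suc k) ^ n * c k ^ r)
      = (\<Sum>k<p. \<Sum>i=0..n. int (n choose i) * (int k ^ i * c k ^ r))"
  proof (intro sum.cong refl)
    fix k
    have "int (Suc k) ^ n = (\<Sum>i=0..n. int (n choose i) * int k ^ i)"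
      using binomial_ring[of "int k" 1 n] by (simp add: atLeast0AtMost add.commute)
    then show "int (Suc k) ^ n * c k ^ r = (\<Sum>i=0..n. int (n choose i) * (int k ^ i * c k ^ r))"
      by (simp add: sum_distrib_right mult.assoc)
  qed
  also have "\<dots> = (\<Sum>i=0..n. int (n choose i) * cleared_sum p r i)"
    by (subst sum.swap) (simp add: cleared_sum_def p c_def sum_distrib_left del: sum.lessThan_Suc)
  finally show ?thesis .
qed

text \<open>The sign on \<open>g\<close> offsets the factor (-1)^r between the cleared sum and the
  \<open>p\<close>-component of \<open>D_\<A>\<close>.\<close>

lemma cleared_sum_cong:
  assumes r: "r \<ge> 1" and p: "prime p"
  shows "[cleared_sum p r n = (\<Sum>j=0..r-1. b r j n * cleared_sum p r j) + (-1) ^ r * g r n] (mod int p)"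
proof (induction n rule: less_induct)
  case (less n)
  define S where "S = cleared_sum p r"
  \<comment> \<open>n = r stands apart: \<open>b\<close> already follows its recurrence there, but
    \<open>g\<close> still takes an initial value.\<close>
  consider "n < r" | "n = r" | m where "m \<ge> 1" "n = m + r"
    by (metis One_nat_def Suc_leI add.commute le_add_diff_inverse less_imp_le linorder_cases zero_less_diff)
  then have "[S n = (\<Sum>j=0..r-1. b r j n * S j) + (-1) ^ r * g r n] (mod int p)"
  proof cases
    case 1
    then have "n \<in> {0..r-1}" by auto
    then have "S n = (\<Sum>j=0..r-1. b r j n * S j) + (-1) ^ r * g r n"
      using 1 by (simp add: b_init g_init if_distrib[of "\<lambda>x. x * _"] sum.delta cong: if_cong)
    then show ?thesis by (metis cong_refl)
  next
    case 2
    have "b r j n = (if j = 0 then 1 else 0)" for j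
      using b_rec[OF r, of j 0] r 2 by (simp add: b_init)
    \<comment> \<open>The initial value (-1)^(r-1) of \<open>g\<close> is what accounts for the
      correction -p^0 = -1.\<close>
    moreover have "(-1) ^ r * g r n = -1"
      using r 2 by (simp add: g_init power_add[symmetric] flip: power_mult)
    moreover have "S n = S 0 - 1"
      using cleared_sum_rec[OF r, of p 0] prime_ge_1_nat[OF p] 2 by (simp add: S_def)
    ultimately have "S n = (\<Sum>j=0..r-1. b r j n * S j) + (-1) ^ r * g r n"
      by (simp add: if_distrib[of "\<lambda>x. x * _"] sum.delta cong: if_cong)
    then show ?thesis by (metis cong_refl)
  next
    case (3 m)
    have "S n = (\<Sum>k=0..m. int (m choose k) * S k) - int p ^ m"
      using cleared_sum_rec[OF r, of p m] prime_ge_1_nat[OF p] 3 by (simp add: S_def)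
    \<comment> \<open>p divides p^m because m \<ge> 1.\<close>
    also have "[\<dots> = (\<Sum>k=0..m. int (m choose k) * S k) - 0] (mod int p)"
      using 3 by (intro cong_diff cong_refl) (simp add: cong_0_iff dvd_power)
    also have "(\<Sum>k=0..m. int (m choose k) * S k) - 0 = (\<Sum>k=0..m. int (m choose k) * S k)"
      by simp
    also have "[\<dots> = (\<Sum>k=0..m. int (m choose k) *
        ((\<Sum>j=0..r-1. b r j k * S j) + (-1) ^ r * g r k))] (mod int p)"
      \<comment> \<open>The induction hypothesis applies since k \<le> m < m + r = n.\<close>
      using less.IH 3 r unfolding S_def by (intro cong_sum cong_mult cong_refl) auto
    also have "(\<Sum>k=0..m. int (m choose k) * ((\<Sum>j=0..r-1. b r j k * S j) + (-1) ^ r * g r k))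
        = (\<Sum>k=0..m. \<Sum>j=0..r-1. int (m choose k) * b r j k * S j)
          + (-1) ^ r * (\<Sum>k=0..m. int (m choose k) * g r k)"
      by (simp add: distrib_left sum.distrib sum_distrib_left mult_ac)
    also have "\<dots> = (\<Sum>j=0..r-1. b r j n * S j) + (-1) ^ r * g r n"
      using r 3 by (subst sum.swap) (simp add: b_rec g_rec sum_distrib_right)
    finally show ?thesis .
  qed
  then show ?case by (simp add: S_def)
qed

lemma rat_mod_of_int:
  assumes "prime p"
  shows "rat_mod p (of_int c) = c mod int p"
  using rat_mod_eqI[of p 1 c c] assms prime_gt_1_nat[OF assms] by simp

lemma rat_mod_power_sum:
  assumes p: "prime p"
  shows "rat_mod p (\<Sum>k=0..p-1. of_nat k ^ n / fact k ^ r) = ((-1) ^ r * cleared_sum p r n) mod int p"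
proof -
  have "{0..p-1} = {..<p}"
    using prime_gt_0_nat[OF p] by auto
  moreover have "of_nat k ^ n / fact k ^ r
      = of_int (int k ^ n * int (fact (p - 1) div fact k) ^ r) / (of_int (fact (p - 1) ^ r) :: rat)"
    if "k < p" for k
  proof -
    obtain q :: nat where q: "fact (p - 1) = fact k * q"
      using fact_dvd[of k "p - 1"] \<open>k < p\<close> unfolding dvd_def by fastforce
    then have "(fact (p - 1) :: rat) = fact k * of_nat q"
      by (metis of_nat_fact of_nat_mult)
    with q have "of_nat (fact (p - 1) div fact k) = (fact (p - 1) / fact k :: rat)"
      by simp
    then show ?thesis
      by (simp add: power_divide)
  qed
  ultimately have eq: "(\<Sum>k=0..p-1. of_nat k ^ n / fact k ^ r)
      = of_int (cleared_sum p r n) / (of_int (fact (p - 1) ^ r) :: rat)"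
    by (simp add: cleared_sum_def sum_divide_distrib)
  have wilson: "[fact (p - 1) ^ r = (-1) ^ r] (mod int p)"
    using wilson_theorem[OF p] by (intro cong_pow)
  have "\<not> int p dvd fact (p - 1) ^ r"
  proof
    assume "int p dvd fact (p - 1) ^ r"
    then have "p dvd fact (p - 1) ^ r"
      by (metis int_dvd_int_iff of_nat_fact of_nat_power)
    then have "p \<le> p - 1"
      using prime_dvd_power[OF p] prime_dvd_fact_iff[OF p] by blast
    then show False
      using prime_gt_0_nat[OF p] by simp
  qed
  \<comment> \<open>\<open>rat_mod_eqI\<close> asks for the claimed residue times the denominator.
    By Wilson the two signs multiply to (-1)^(2r) = 1, leaving the numerator.\<close>
  moreover have "[(-1) ^ r * cleared_sum p r n * fact (p - 1) ^ r
      = (-1) ^ r * cleared_sum p r n * (-1) ^ r] (mod int p)"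
    by (intro cong_mult cong_refl wilson)
  moreover have "(-1) ^ r * cleared_sum p r n * (-1) ^ r = cleared_sum p r n"
    by simp
  ultimately show ?thesis
    unfolding eq by (intro rat_mod_eqI[OF p]) auto
qed

lemma mod_prime_range: "prime p \<Longrightarrow> x mod int p \<in> {0..<int p}"
  using prime_gt_0_nat[of p] by simp

text \<open>Agreement at every prime makes the representatives themselves equal, so no range
  condition is required.\<close>

lemma \<A>_class_cong:
  assumes "\<And>p. prime p \<Longrightarrow> f p = h p"
  shows "\<A>_class f = \<A>_class h"
proof -
  have "(\<lambda>p\<in>primes. f p) = (\<lambda>p\<in>primes. h p)"
    using assms by (intro restrict_ext) simp
  then show ?thesis
    by (simp only: \<A>_class_def)
qed

lemma \<A>_class_mod_cong:
  assumes "\<And>p. prime p \<Longrightarrow> [f p = h p] (mod int p)"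
  shows "\<A>_class (\<lambda>p. f p mod int p) = \<A>_class (\<lambda>p. h p mod int p)"
  using assms by (intro \<A>_class_cong) (simp add: cong_def)

text \<open>Reducing inside the class puts the representatives in range automatically, which gives
  an unconditional rewrite rule.\<close>

lemma \<A>_class_mod_add:
  "\<A>_class (\<lambda>p. f p mod int p) \<oplus>\<^bsub>\<A>\<^esub> \<A>_class (\<lambda>p. h p mod int p) = \<A>_class (\<lambda>p. (f p + h p) mod int p)"
  by (subst \<A>_class_add[OF mod_prime_range mod_prime_range]) (simp_all add: mod_simps)

lemma \<A>_class_mod_mult:
  "\<A>_class (\<lambda>p. f p mod int p) \<otimes>\<^bsub>\<A>\<^esub> \<A>_class (\<lambda>p. h p mod int p) = \<A>_class (\<lambda>p. (f p * h p) mod int p)"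
  by (subst \<A>_class_mult[OF mod_prime_range mod_prime_range]) (simp_all add: mod_simps)

lemma \<A>_of_rat_of_int: "\<A>_of_rat (of_int c) = \<A>_class (\<lambda>p. c mod int p)"
  unfolding \<A>_of_rat_def
  by (intro \<A>_class_cong) (simp add: rat_mod_of_int)

lemma \<A>_class_mod_finsum:
  assumes "finite J"
  shows "(\<Oplus>\<^bsub>\<A>\<^esub> j \<in> J. \<A>_class (\<lambda>p. f j p mod int p)) = \<A>_class (\<lambda>p. (\<Sum>j\<in>J. f j p) mod int p)"
  using assms
proof (induction J)
  interpret cring \<A> by (rule cring_\<A>)
  case empty
  then show ?case
    \<comment> \<open>The empty sum is the zero of \<open>\<A>\<close>, identified with a class
      through the image of the rational 0.\<close>
    using \<A>_of_rat_of_int[of 0] by (simp add: \<A>_of_rat_0)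
next
  interpret cring \<A> by (rule cring_\<A>)
  case (insert i J)
  have "\<A>_class (\<lambda>p. f j p mod int p) \<in> carrier \<A>" for j
    by (intro \<A>_class_closed mod_prime_range)
  then show ?case
    using insert by (simp add: \<A>_class_mod_add)
qed

lemma D_\<A>_eq: "D_\<A> r n = \<A>_class (\<lambda>p. ((-1) ^ r * cleared_sum p r n) mod int p)"
  unfolding D_\<A>_def
  by (intro \<A>_class_cong) (rule rat_mod_power_sum)

theorem theorem1p3:
  fixes r n :: nat
  assumes "r \<ge> 1"
  shows "D_\<A> r n =
    (\<Oplus>\<^bsub>\<A>\<^esub> j \<in> {0..r-1}. \<A>_of_rat (of_int (b r j n)) \<otimes>\<^bsub>\<A>\<^esub> D_\<A> r j)
      \<oplus>\<^bsub>\<A>\<^esub> \<A>_of_rat (of_int (g r n))"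
proof -
  \<comment> \<open>Multiplying \<open>cleared_sum_cong\<close> by (-1)^r turns each cleared sum
    into the component of \<open>D_\<A>\<close> and cancels the sign of \<open>g\<close>.\<close>
  have "[(-1) ^ r * cleared_sum p r n
      = (\<Sum>j=0..r-1. b r j n * ((-1) ^ r * cleared_sum p r j)) + g r n] (mod int p)"
    if "prime p" for p
  proof -
    have "(-1) ^ r * (\<Sum>j=0..r-1. b r j n * cleared_sum p r j)
        = (\<Sum>j=0..r-1. b r j n * ((-1) ^ r * cleared_sum p r j))"
      by (simp add: sum_distrib_left mult.left_commute)
    then have "(-1) ^ r * ((\<Sum>j=0..r-1. b r j n * cleared_sum p r j) + (-1) ^ r * g r n)
        = (\<Sum>j=0..r-1. b r j n * ((-1) ^ r * cleared_sum p r j)) + g r n"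
      by (simp add: distrib_left)
    then show ?thesis
      using cong_mult[OF cong_refl cleared_sum_cong[OF assms that]] by metis
  qed
  \<comment> \<open>The rewrite rules collapse the right-hand side to a single class, so the claim
    becomes this componentwise congruence.\<close>
  from \<A>_class_mod_cong[OF this] show ?thesis
    by (simp only: D_\<A>_eq \<A>_of_rat_of_int \<A>_class_mod_mult \<A>_class_mod_finsum \<A>_class_mod_add
        finite_atLeastAtMost)
qed

end
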